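(* Let $Y\in\mathcal{Y}(G_C)$ and $\lambda\in[1,\infty)$. Then $$\mathcal{Q}_C=\big\{Q^\xi(\lambda I-Y)^{-1}\ :\ Q^\xi\in\mathcal{Q}_C\big\}.$$
   Context: There are $N$ subsystems indexed by $V=\{1,\dots,N\}$ and a finite horizon $T\ge1$. Subsystem $i$ has state $x_i(t)\in\mathbb{R}^{n_x^i}$, input $u_i(t)\in\mathbb{R}^{n_u^i}$ and disturbance $w_i(t)\in\mathbb{R}^{n_x^i}$, with dynamics $x_i(t+1)=\sum_{j=1}^N(A_{ij}(t)x_j(t)+B_{ij}(t)u_j(t))+w_i(t)$, $t=0,\dots,T-1$. Put $n_x=\sum_in_x^i$, $n_u=\sum_in_u^i$, $N_x=n_x(T+1)$, $N_u=n_uT$. A directed information graph $G_I=(V,E_I)$ is given. Let $V_I^-(i)=\{j:(j,i)\in E_I\}$, $V_A^-(i)=\{j:\exists t\in\{0,\dots,T-1\},\,A_{ij}(t)\ne0\}$, $V_B^-(i)=\{j:\exists t\in\{0,\dots,T-1\},\,B_{ij}(t)\neq0\}$. Define $$\mathcal{N}(i)=\Big\{j\in V_I^-(i): V_A^-(j)\subseteq V_I^-(i),\ \bigcup_{k\in V_B^-(j)}V_I^-(k)\subseteq V_I^-(i)\Big\},\qquad \mathcal{C}(i)=V_I^-(i)\setminus\mathcal{N}(i).$$ $\mathcal{Q}_C$ is the set of matrices $Q\in\mathbb{R}^{N_u\times N_x}$, viewed as $T\times(T+1)$ block matrices with blocks $Q(t,s)\in\mathbb{R}^{n_u\times n_x}$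 ($0\le t\le T-1$, $0\le s\le T$), each subdivided into $N\times N$ blocks $[Q(t,s)]_{ij}\in\mathbb{R}^{n_u^i\times n_x^j}$, such that $[Q(t,s)]_{ij}=0$ unless $j\in\mathcal{C}(i)$ and $t\ge s$. The information coupling graph $G_C=(V,E_C)$ has $E_C=\{(j,i)\in E_I: j\in\mathcal{C}(i)\}$, with out-neighborhoods $V_C^+(j)=\{i:(j,i)\in E_C\}$. $\mathcal{Y}(G_C)$ is the subspace of matrices $Y\in\mathbb{R}^{N_x\times N_x}$, viewed as $(T+1)\times(T+1)$ block matrices with blocks $Y(t,s)\in\mathbb{R}^{n_x\times n_x}$ ($0\le t,s\le T$), each subdivided into $N\times N$ blocks $[Y(t,s)]_{ij}\in\mathbb{R}^{n_x^i\times n_x^j}$, that are strictly block lower triangular ($Y(t,s)=0$ for $t\le s$) and satisfy $[Y(t,s)]_{ij}=0$ whenever $V_C^+(i)\nsubseteq V_C^+(j)$. $I$ is the identity matrix of size $N_x$. *)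

theory Defs
  imports "Jordan_Normal_Form.Gauss_Jordan_Elimination"
begin

text \<open>
  \<open>A i j t\<close> and \<open>B i j t\<close> stand for the blocks of the dynamics
  \<open>x\<^sub>i(t+1) = (\<Sum>j. A\<^sub>i\<^sub>j(t) x\<^sub>j(t) + B\<^sub>i\<^sub>j(t) u\<^sub>j(t)) + w\<^sub>i(t)\<close>; an edge \<open>(j, i)\<close> of \<open>info_edges\<close>
  goes from \<open>j\<close> to \<open>i\<close>.
\<close>

record network =
  num_subsys :: nat
  horizon :: nat
  state_dim :: "nat \<Rightarrow> nat"
  input_dim :: "nat \<Rightarrow> nat"
  A_blk :: "nat \<Rightarrow> nat \<Rightarrow> nat \<Rightarrow> real mat"
  B_blk :: "nat \<Rightarrow> nat \<Rightarrow> nat \<Rightarrow> real mat"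
  info_edges :: "(nat \<times> nat) set"

definition subsystems :: "network \<Rightarrow> nat set" where
  "subsystems S = {1..num_subsys S}"

definition wf_network :: "network \<Rightarrow> bool" where
  "wf_network S \<longleftrightarrow>
     horizon S \<ge> 1 \<and>
     (\<forall>i\<in>subsystems S. \<forall>j\<in>subsystems S. \<forall>t<horizon S.
        A_blk S i j t \<in> carrier_mat (state_dim S i) (state_dim S j) \<and>
        B_blk S i j t \<in> carrier_mat (state_dim S i) (input_dim S j)) \<and>
     info_edges S \<subseteq> subsystems S \<times> subsystems S"

definition n_x :: "network \<Rightarrow> nat" where
  "n_x S = (\<Sum>i\<in>subsystems S. state_dim S i)"

definition n_u :: "network \<Rightarrow> nat" where
  "n_u S = (\<Sum>i\<in>subsystems S. input_dim S i)"

definition N_x :: "network \<Rightarrow> nat" where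
  "N_x S = n_x S * (horizon S + 1)"

definition N_u :: "network \<Rightarrow> nat" where
  "N_u S = n_u S * horizon S"

definition V_I_in :: "network \<Rightarrow> nat \<Rightarrow> nat set" where
  "V_I_in S i = {j. (j, i) \<in> info_edges S}"

definition V_A_in :: "network \<Rightarrow> nat \<Rightarrow> nat set" where
  "V_A_in S i = {j \<in> subsystems S. \<exists>t<horizon S.
     A_blk S i j t \<noteq> 0\<^sub>m (state_dim S i) (state_dim S j)}"

definition V_B_in :: "network \<Rightarrow> nat \<Rightarrow> nat set" where
  "V_B_in S i = {j \<in> subsystems S. \<exists>t<horizon S.
     B_blk S i j t \<noteq> 0\<^sub>m (state_dim S i) (input_dim S j)}"

definition Nset :: "network \<Rightarrow> nat \<Rightarrow> nat set" where
  "Nset S i = {j \<in> V_I_in S i.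
     V_A_in S j \<subseteq> V_I_in S i \<and> (\<Union>k\<in>V_B_in S j. V_I_in S k) \<subseteq> V_I_in S i}"

definition Cset :: "network \<Rightarrow> nat \<Rightarrow> nat set" where
  "Cset S i = V_I_in S i - Nset S i"

definition E_C :: "network \<Rightarrow> (nat \<times> nat) set" where
  "E_C S = {(j, i) \<in> info_edges S. j \<in> Cset S i}"

definition V_C_out :: "network \<Rightarrow> nat \<Rightarrow> nat set" where
  "V_C_out S j = {i. (j, i) \<in> E_C S}"

text \<open>Block \<open>M(t,s)\<close> of a matrix partitioned into blocks of the constant size \<open>r \<times> c\<close>;
  \<open>t\<close> and \<open>s\<close> count from 0.\<close>

definition time_block :: "nat \<Rightarrow> nat \<Rightarrow> 'a mat \<Rightarrow> nat \<Rightarrow> nat \<Rightarrow> 'a mat" where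
  "time_block r c M t s = mat r c (\<lambda>(k, l). M $$ (t * r + k, s * c + l))"

text \<open>Block \<open>[M]\<^sub>i\<^sub>j\<close>, of size \<open>p i \<times> q j\<close>, of a matrix partitioned into row blocks of heights
  \<open>p 1, p 2, \<dots>\<close> and column blocks of widths \<open>q 1, q 2, \<dots>\<close>; \<open>i\<close> and \<open>j\<close> count from 1.\<close>

definition subsys_block ::
  "(nat \<Rightarrow> nat) \<Rightarrow> (nat \<Rightarrow> nat) \<Rightarrow> 'a mat \<Rightarrow> nat \<Rightarrow> nat \<Rightarrow> 'a mat" where
  "subsys_block p q M i j =
     mat (p i) (q j) (\<lambda>(k, l). M $$ ((\<Sum>h\<in>{1..<i}. p h) + k, (\<Sum>h\<in>{1..<j}. q h) + l))"

definition Q_C :: "network \<Rightarrow> real mat set" where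
  "Q_C S = {Q \<in> carrier_mat (N_u S) (N_x S).
     \<forall>t<horizon S. \<forall>s\<le>horizon S. \<forall>i\<in>subsystems S. \<forall>j\<in>subsystems S.
       \<not> (j \<in> Cset S i \<and> t \<ge> s) \<longrightarrow>
       subsys_block (input_dim S) (state_dim S) (time_block (n_u S) (n_x S) Q t s) i j
         = 0\<^sub>m (input_dim S i) (state_dim S j)}"

definition Y_GC :: "network \<Rightarrow> real mat set" where
  "Y_GC S = {Y \<in> carrier_mat (N_x S) (N_x S).
     (\<forall>t\<le>horizon S. \<forall>s\<le>horizon S. t \<le> s \<longrightarrow>
        time_block (n_x S) (n_x S) Y t s = 0\<^sub>m (n_x S) (n_x S)) \<and>
     (\<forall>t\<le>horizon S. \<forall>s\<le>horizon S. \<forall>i\<in>subsystems S. \<forall>j\<in>subsystems S.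
        \<not> V_C_out S i \<subseteq> V_C_out S j \<longrightarrow>
        subsys_block (state_dim S) (state_dim S) (time_block (n_x S) (n_x S) Y t s) i j
          = 0\<^sub>m (state_dim S i) (state_dim S j))}"

end

theory Submission
  imports Defs "Jordan_Normal_Form.Determinant"
begin

text \<open>
  Both \<^term>\<open>Q_C S\<close> and \<^term>\<open>Y_GC S\<close> are spaces of matrices with prescribed zero entries, so the
  theorem is one about supports. Write \<open>P r c\<close> if the entry \<open>(r, c)\<close> may be nonzero in \<^term>\<open>Q_C S\<close>
  and \<open>K d c\<close> if the entry \<open>(d, c)\<close> may be nonzero in \<^term>\<open>Y_GC S\<close>. Two facts carry the proof.

  \<^item> \<open>P r d\<close> and \<open>K d c\<close> imply \<open>P r c\<close>. If \<open>r\<close>, \<open>d\<close>, \<open>c\<close> belong to the subsystems \<open>i\<close>, \<open>k\<close>, \<open>j\<close>, then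
    \<open>P r d\<close> says \<open>i \<in> V_C_out S k\<close>, while \<open>K d c\<close> says \<open>V_C_out S k \<subseteq> V_C_out S j\<close>; so
    \<open>i \<in> V_C_out S j\<close>, which is \<open>j \<in> Cset S i\<close>. The time order is respected because the times \<open>t\<close>,
    \<open>u\<close>, \<open>s\<close> of \<open>r\<close>, \<open>d\<close>, \<open>c\<close> satisfy \<open>t \<ge> u > s\<close>. (Lemma \<open>Q_pattern_absorbs_Y_pattern\<close>.)
  \<^item> \<open>K d c\<close> implies \<open>c < d\<close>, since a strictly block lower triangular matrix is strictly lower
    triangular. (Lemma \<open>Y_pattern_strictly_lower\<close>.)

  By the second fact \<open>M = \<lambda>I - Y\<close> is triangular with \<open>\<lambda> \<noteq> 0\<close> on its diagonal, hence invertible.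
  By the first, \<open>Q \<mapsto> Q M\<close> preserves the pattern \<open>P\<close>. The inverse map preserves it as well: solving
  \<open>R M = Q\<close> for \<open>R\<close> by back substitution, from the last column to the first, expresses column \<open>c\<close> of
  \<open>R\<close> by column \<open>c\<close> of \<open>Q\<close> and the products \<open>R(r, d) Y(d, c)\<close> with \<open>d > c\<close>, and the first fact
  applies again (lemma \<open>supported_mult_iff\<close>). Right multiplication by \<open>M\<close> is therefore a
  bijection of \<^term>\<open>Q_C S\<close> onto itself, and so is right multiplication by its inverse.
\<close>

section \<open>Matrices supported on a pattern\<close>

definition supported :: "(nat \<Rightarrow> nat \<Rightarrow> bool) \<Rightarrow> 'a::zero mat \<Rightarrow> bool" where
  "supported P M \<longleftrightarrow> (\<forall>r<dim_row M. \<forall>c<dim_col M. M $$ (r, c) \<noteq> 0 \<longrightarrow> P r c)"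

lemma index_mult_shifted:
  fixes R Y :: "'a::comm_ring_1 mat"
  assumes "R \<in> carrier_mat m n" "Y \<in> carrier_mat n n" "r < m" "c < n"
  shows "(R * (a \<cdot>\<^sub>m 1\<^sub>m n - Y)) $$ (r, c) = a * R $$ (r, c) - (\<Sum>d<n. R $$ (r, d) * Y $$ (d, c))"
proof -
  have "(R * (a \<cdot>\<^sub>m 1\<^sub>m n - Y)) $$ (r, c)
      = (\<Sum>d<n. R $$ (r, d) * ((if d = c then a else 0) - Y $$ (d, c)))"
    using assms by (auto simp: scalar_prod_def atLeast0LessThan intro!: sum.cong)
  also have "\<dots> = (\<Sum>d<n. if d = c then R $$ (r, d) * a else 0) - (\<Sum>d<n. R $$ (r, d) * Y $$ (d, c))"
    unfolding sum_subtractf[symmetric] by (intro sum.cong) (auto simp: algebra_simps)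
  also have "(\<Sum>d<n. if d = c then R $$ (r, d) * a else 0) = a * R $$ (r, c)"
    using assms by (simp add: mult.commute)
  finally show ?thesis .
qed

text \<open>
  Absorption makes every product \<open>R(r, d) Y(d, c)\<close> vanish outside \<open>P\<close> as soon as \<open>R\<close> is supported on
  \<open>P\<close>. In the direction from the product to \<open>R\<close> this is known only for the columns \<open>d > c\<close>
  treated before, and these suffice because \<open>Y\<close> is strictly lower triangular.
\<close>

lemma supported_mult_iff:
  fixes R Y :: "'a::field mat"
  assumes R: "R \<in> carrier_mat m n" and Y: "Y \<in> carrier_mat n n"
    and supp: "supported K Y" and a: "a \<noteq> 0"
    and lower: "\<And>d c. d < n \<Longrightarrow> c < n \<Longrightarrow> K d c \<Longrightarrow> c < d"
    and absorb: "\<And>r d c. r < m \<Longrightarrow> d < n \<Longrightarrow> c < n \<Longrightarrow> P r d \<Longrightarrow> K d c \<Longrightarrow> P r c"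
  shows "supported P (R * (a \<cdot>\<^sub>m 1\<^sub>m n - Y)) \<longleftrightarrow> supported P R"
proof
  have K: "K d c" if "d < n" "c < n" "Y $$ (d, c) \<noteq> 0" for d c
    using supp that Y by (auto simp: supported_def)
  note entry = index_mult_shifted[OF R Y, where a = a]
  {
    assume RP: "supported P R"
    have "P r c" if rc: "r < m" "c < n" and nz: "(R * (a \<cdot>\<^sub>m 1\<^sub>m n - Y)) $$ (r, c) \<noteq> 0" for r c
    proof (rule ccontr)
      assume nP: "\<not> P r c"
      have "R $$ (r, d) * Y $$ (d, c) = 0" if "d < n" for d
        using RP R absorb[OF rc(1) that rc(2)] K[OF that rc(2)] nP rc that
        by (auto simp: supported_def)
      moreover have "R $$ (r, c) = 0" using RP R nP rc by (auto simp: supported_def)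
      ultimately show False using nz entry[OF rc] by (simp add: sum.neutral)
    qed
    then show "supported P (R * (a \<cdot>\<^sub>m 1\<^sub>m n - Y))" using R Y by (simp add: supported_def)
  next
    assume QP: "supported P (R * (a \<cdot>\<^sub>m 1\<^sub>m n - Y))"
    have "P r c" if "r < m" "c < n" "R $$ (r, c) \<noteq> 0" for r c
      using that
    proof (induction "n - c" arbitrary: c rule: less_induct)
      case less
      show ?case
      proof (rule ccontr)
        assume nP: "\<not> P r c"
        have "R $$ (r, d) * Y $$ (d, c) = 0" if d: "d < n" for d
        proof (rule ccontr)
          assume "R $$ (r, d) * Y $$ (d, c) \<noteq> 0"
          then have Rd: "R $$ (r, d) \<noteq> 0" and Kdc: "K d c" using K d less.prems by auto
          have "n - d < n - c" using lower[OF d _ Kdc] d less.prems by auto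
          then have "P r d" using less.hyps d Rd less.prems by blast
          then show False using absorb[OF _ d _ _ Kdc] nP less.prems by blast
        qed
        moreover have "(R * (a \<cdot>\<^sub>m 1\<^sub>m n - Y)) $$ (r, c) = 0"
          using QP nP less.prems R Y by (auto simp: supported_def)
        ultimately show False using entry[OF less.prems(1,2)] less.prems(3) a by (simp add: sum.neutral)
      qed
    qed
    then show "supported P R" using R by (simp add: supported_def)
  }
qed

lemma det_shifted_strictly_lower:
  fixes Y :: "'a::field mat"
  assumes Y: "Y \<in> carrier_mat n n" and supp: "supported K Y"
    and lower: "\<And>d c. d < n \<Longrightarrow> c < n \<Longrightarrow> K d c \<Longrightarrow> c < d"
  shows "det (a \<cdot>\<^sub>m 1\<^sub>m n - Y) = a ^ n"
proof -
  let ?M = "a \<cdot>\<^sub>m 1\<^sub>m n - Y"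
  have M: "?M \<in> carrier_mat n n" using Y by (rule minus_carrier_mat)
  have Y0: "Y $$ (d, c) = 0" if "d < n" "c < n" "d \<le> c" for d c
    using supp lower[OF that(1,2)] that Y unfolding supported_def by (metis carrier_matD leD)
  have "?M $$ (i, j) = 0" if "i < j" "j < n" for i j
    using that Y Y0 by simp
  then have "det ?M = prod_list (diag_mat ?M)"
    by (rule det_lower_triangular[OF _ M])
  also have "diag_mat ?M = map (\<lambda>_. a) [0..<n]"
    using Y Y0 by (auto simp: diag_mat_def)
  also have "prod_list \<dots> = a ^ n" by (simp add: map_replicate_const)
  finally show ?thesis .
qed

lemma inverse_from_det:
  fixes M :: "'a::field mat"
  assumes M: "M \<in> carrier_mat n n" and det: "det M \<noteq> 0"
  shows "the (mat_inverse M) \<in> carrier_mat n n"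
    and "M * the (mat_inverse M) = 1\<^sub>m n"
    and "the (mat_inverse M) * M = 1\<^sub>m n"
proof -
  have "M \<in> Units (ring_mat TYPE('a) n ())" using det_non_zero_imp_unit[OF M det] .
  then obtain B where "mat_inverse M = Some B"
    using mat_inverse(1)[OF M, where b = "()"] by (cases "mat_inverse M") auto
  with mat_inverse(2)[OF M this]
  show "the (mat_inverse M) \<in> carrier_mat n n"
    and "M * the (mat_inverse M) = 1\<^sub>m n"
    and "the (mat_inverse M) * M = 1\<^sub>m n" by auto
qed

section \<open>Blocks as ranges of indices\<close>

text \<open>
  The global indices of subsystem \<open>i\<close> at time \<open>t\<close>, if each time step contributes \<open>n\<close> indices, of which
  subsystem \<open>h\<close> takes \<open>p h\<close>.
\<close>

definition block_range :: "(nat \<Rightarrow> nat) \<Rightarrow> nat \<Rightarrow> nat \<Rightarrow> nat \<Rightarrow> nat set" where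
  "block_range p n t i = {t * n + sum p {1..<i} ..< t * n + sum p {1..i}}"

lemma sum_block_end:
  fixes p :: "nat \<Rightarrow> nat"
  shows "i \<ge> 1 \<Longrightarrow> sum p {1..i} = sum p {1..<i} + p i"
  by (cases i) (simp_all add: atLeastLessThanSuc_atLeastAtMost)

lemma sum_block_end_le:
  fixes p :: "nat \<Rightarrow> nat"
  shows "i \<in> {1..N} \<Longrightarrow> sum p {1..i} \<le> sum p {1..N}"
  by (intro sum_mono2) auto

lemma block_range_bounds:
  assumes "a \<in> block_range p (sum p {1..N}) t i" "i \<in> {1..N}"
  shows "t * sum p {1..N} \<le> a" "a < Suc t * sum p {1..N}"
  using assms sum_block_end_le[OF assms(2), of p] by (auto simp: block_range_def)

lemma block_range_less:
  assumes "a \<in> block_range p (sum p {1..N}) t i" "i \<in> {1..N}" "t < T"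
  shows "a < sum p {1..N} * T"
proof -
  have "a < Suc t * sum p {1..N}" using block_range_bounds assms by blast
  also have "\<dots> \<le> T * sum p {1..N}" using assms(3) by (intro mult_right_mono) auto
  finally show ?thesis by (simp add: mult.commute)
qed

lemma subsystem_of_offset:
  fixes p :: "nat \<Rightarrow> nat"
  shows "b < sum p {1..N} \<Longrightarrow> \<exists>i\<in>{1..N}. sum p {1..<i} \<le> b \<and> b < sum p {1..i}"
proof (induction N)
  case (Suc N)
  show ?case
  proof (cases "b < sum p {1..N}")
    case True
    with Suc.IH obtain i where "i \<in> {1..N}" "sum p {1..<i} \<le> b" "b < sum p {1..i}" by blast
    then show ?thesis by (intro bexI[of _ i]) auto
  next
    case False
    then show ?thesis
      using Suc.prems by (intro bexI[of _ "Suc N"]) (auto simp: atLeastLessThanSuc_atLeastAtMost)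
  qed
qed simp

lemma block_range_cover:
  assumes "a < sum p {1..N} * T"
  obtains t i where "t < T" "i \<in> {1..N}" "a \<in> block_range p (sum p {1..N}) t i"
proof -
  let ?n = "sum p {1..N}"
  have n: "?n > 0" using assms by (cases "?n") auto
  obtain i where i: "i \<in> {1..N}" "sum p {1..<i} \<le> a mod ?n" "a mod ?n < sum p {1..i}"
    using subsystem_of_offset[of "a mod ?n" p N] n by auto
  have "a div ?n < T" using assms n by (simp add: less_mult_imp_div_less mult.commute)
  moreover have "a = a div ?n * ?n + a mod ?n" by (rule div_mult_mod_eq[symmetric])
  then have "a \<in> block_range p ?n (a div ?n) i"
    using i by (simp only: block_range_def atLeastLessThan_iff) linarith
  ultimately show ?thesis using that i(1) by blast
qed

lemma subsys_time_block_zero_iff: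
  assumes i: "i \<in> {1..N}" and j: "j \<in> {1..N}"
  shows "subsys_block p q (time_block (sum p {1..N}) (sum q {1..N}) M t s) i j = 0\<^sub>m (p i) (q j)
    \<longleftrightarrow> (\<forall>r\<in>block_range p (sum p {1..N}) t i. \<forall>c\<in>block_range q (sum q {1..N}) s j. M $$ (r, c) = 0)"
    (is "?L \<longleftrightarrow> ?R")
proof -
  let ?o = "\<lambda>p i. \<Sum>h\<in>{1..<i}. p h"
  have bi: "?o p i + k < sum p {1..N}" if "k < p i" for k
    using sum_block_end_le[OF i, of p] sum_block_end[of i p] i that by auto
  have bj: "?o q j + l < sum q {1..N}" if "l < q j" for l
    using sum_block_end_le[OF j, of q] sum_block_end[of j q] j that by auto
  have "?L \<longleftrightarrow> (\<forall>k<p i. \<forall>l<q j.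
      M $$ (t * sum p {1..N} + (?o p i + k), s * sum q {1..N} + (?o q j + l)) = 0)"
    using bi bj by (auto simp: mat_eq_iff subsys_block_def time_block_def)
  also have "\<dots> \<longleftrightarrow> ?R"
  proof
    assume L: "\<forall>k<p i. \<forall>l<q j.
      M $$ (t * sum p {1..N} + (?o p i + k), s * sum q {1..N} + (?o q j + l)) = 0"
    show ?R
    proof (intro ballI)
      fix r c
      assume r: "r \<in> block_range p (sum p {1..N}) t i" and c: "c \<in> block_range q (sum q {1..N}) s j"
      obtain k where "k < p i" "r = t * sum p {1..N} + (?o p i + k)"
        using r sum_block_end[of i p] i
        by (intro that[of "r - (t * sum p {1..N} + ?o p i)"]) (auto simp: block_range_def)
      moreover obtain l where "l < q j" "c = s * sum q {1..N} + (?o q j + l)"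
        using c sum_block_end[of j q] j
        by (intro that[of "c - (s * sum q {1..N} + ?o q j)"]) (auto simp: block_range_def)
      ultimately show "M $$ (r, c) = 0" using L by blast
    qed
  next
    assume R: ?R
    show "\<forall>k<p i. \<forall>l<q j.
      M $$ (t * sum p {1..N} + (?o p i + k), s * sum q {1..N} + (?o q j + l)) = 0"
      using sum_block_end[of i p] sum_block_end[of j q] i j
      by (intro allI impI R[rule_format]) (auto simp: block_range_def)
  qed
  finally show ?thesis .
qed

section \<open>The patterns of the two matrix spaces\<close>

abbreviation state_range :: "network \<Rightarrow> nat \<Rightarrow> nat \<Rightarrow> nat set" where
  "state_range S \<equiv> block_range (state_dim S) (n_x S)"

abbreviation input_range :: "network \<Rightarrow> nat \<Rightarrow> nat \<Rightarrow> nat set" where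
  "input_range S \<equiv> block_range (input_dim S) (n_u S)"

text \<open>
  Both patterns quantify over all blocks containing an index. A row or column lies in exactly one
  block, but with this form only its existence (lemma \<open>block_range_cover\<close>) enters the proofs.
\<close>

definition Q_pattern :: "network \<Rightarrow> nat \<Rightarrow> nat \<Rightarrow> bool" where
  "Q_pattern S r c \<longleftrightarrow> (\<forall>t<horizon S. \<forall>s\<le>horizon S. \<forall>i\<in>subsystems S. \<forall>j\<in>subsystems S.
     r \<in> input_range S t i \<longrightarrow> c \<in> state_range S s j \<longrightarrow> j \<in> Cset S i \<and> s \<le> t)"

definition Y_pattern :: "network \<Rightarrow> nat \<Rightarrow> nat \<Rightarrow> bool" where
  "Y_pattern S d c \<longleftrightarrow> (\<forall>t\<le>horizon S. \<forall>s\<le>horizon S. \<forall>i\<in>subsystems S. \<forall>j\<in>subsystems S.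
     d \<in> state_range S t i \<longrightarrow> c \<in> state_range S s j \<longrightarrow> V_C_out S i \<subseteq> V_C_out S j \<and> s < t)"

lemma state_range_cover:
  assumes "c < N_x S"
  obtains s j where "s \<le> horizon S" "j \<in> subsystems S" "c \<in> state_range S s j"
  using assms block_range_cover[of c "state_dim S" "num_subsys S" "horizon S + 1"]
  by (metis N_x_def n_x_def subsystems_def Suc_eq_plus1 less_Suc_eq_le)

lemma Q_C_iff_supported:
  "Q \<in> Q_C S \<longleftrightarrow> Q \<in> carrier_mat (N_u S) (N_x S) \<and> supported (Q_pattern S) Q"
proof -
  have "r < N_u S" if "r \<in> input_range S t i" "i \<in> subsystems S" "t < horizon S" for r t i
    using that block_range_less[of r "input_dim S"] by (simp add: N_u_def n_u_def subsystems_def)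
  moreover have "c < N_x S" if "c \<in> state_range S s j" "j \<in> subsystems S" "s \<le> horizon S" for c s j
    using that block_range_less[of c "state_dim S" "num_subsys S" s j "horizon S + 1"]
    by (simp add: N_x_def n_x_def subsystems_def)
  ultimately have "supported (Q_pattern S) Q \<longleftrightarrow>
    (\<forall>t<horizon S. \<forall>s\<le>horizon S. \<forall>i\<in>subsystems S. \<forall>j\<in>subsystems S. \<not> (j \<in> Cset S i \<and> t \<ge> s) \<longrightarrow>
      (\<forall>r\<in>input_range S t i. \<forall>c\<in>state_range S s j. Q $$ (r, c) = 0))"
    if "dim_row Q = N_u S" "dim_col Q = N_x S"
    unfolding supported_def Q_pattern_def that by meson
  then have supp: "supported (Q_pattern S) Q \<longleftrightarrow>
    (\<forall>t<horizon S. \<forall>s\<le>horizon S. \<forall>i\<in>subsystems S. \<forall>j\<in>subsystems S. \<not> (j \<in> Cset S i \<and> t \<ge> s) \<longrightarrow>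
      (\<forall>r\<in>input_range S t i. \<forall>c\<in>state_range S s j. Q $$ (r, c) = 0))"
    if "Q \<in> carrier_mat (N_u S) (N_x S)"
    using that by blast
  have blk: "subsys_block (input_dim S) (state_dim S) (time_block (n_u S) (n_x S) Q t s) i j
        = 0\<^sub>m (input_dim S i) (state_dim S j)
      \<longleftrightarrow> (\<forall>r\<in>input_range S t i. \<forall>c\<in>state_range S s j. Q $$ (r, c) = 0)"
    if "i \<in> subsystems S" "j \<in> subsystems S" for t s i j
    using that subsys_time_block_zero_iff[of i "num_subsys S" j]
    by (simp add: n_x_def n_u_def subsystems_def)
  show ?thesis
    by (cases "Q \<in> carrier_mat (N_u S) (N_x S)") (simp_all add: Q_C_def blk supp cong: ball_cong)
qed

lemma Y_GC_supported:
  assumes "Y \<in> Y_GC S"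
  shows "supported (Y_pattern S) Y"
proof -
  have blk: "Y $$ (d, c) = 0"
    if "subsys_block (state_dim S) (state_dim S) (time_block (n_x S) (n_x S) Y t s) i j
        = 0\<^sub>m (state_dim S i) (state_dim S j)"
      and "i \<in> subsystems S" "j \<in> subsystems S" "d \<in> state_range S t i" "c \<in> state_range S s j"
    for t s i j d c
    using that subsys_time_block_zero_iff[of i "num_subsys S" j "state_dim S" "state_dim S" Y t s]
    by (simp add: n_x_def subsystems_def)
  have "V_C_out S i \<subseteq> V_C_out S j \<and> s < t"
    if nz: "Y $$ (d, c) \<noteq> 0" and *: "t \<le> horizon S" "s \<le> horizon S"
      "i \<in> subsystems S" "j \<in> subsystems S" "d \<in> state_range S t i" "c \<in> state_range S s j"
    for d c t s i j
  proof
    show "V_C_out S i \<subseteq> V_C_out S j"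
      using assms blk[of t s i j d c] nz * unfolding Y_GC_def by blast
    show "s < t"
    proof (rule ccontr)
      assume "\<not> s < t"
      then have "time_block (n_x S) (n_x S) Y t s = 0\<^sub>m (n_x S) (n_x S)"
        using assms * unfolding Y_GC_def by auto
      moreover have "t * n_x S \<le> d" "d < Suc t * n_x S" "s * n_x S \<le> c" "c < Suc s * n_x S"
        using block_range_bounds[of d "state_dim S" "num_subsys S" t i]
          block_range_bounds[of c "state_dim S" "num_subsys S" s j] *
        by (simp_all add: n_x_def subsystems_def)
      then have "d - t * n_x S < n_x S" "c - s * n_x S < n_x S"
        "time_block (n_x S) (n_x S) Y t s $$ (d - t * n_x S, c - s * n_x S) = Y $$ (d, c)"
        by (auto simp: time_block_def)
      ultimately show False using nz by simp
    qed
  qed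
  then show ?thesis by (auto simp: supported_def Y_pattern_def)
qed

lemma Y_pattern_strictly_lower:
  assumes "d < N_x S" "c < N_x S" "Y_pattern S d c"
  shows "c < d"
proof -
  obtain t i where t: "t \<le> horizon S" "i \<in> subsystems S" "d \<in> state_range S t i"
    using state_range_cover assms(1) .
  obtain s j where s: "s \<le> horizon S" "j \<in> subsystems S" "c \<in> state_range S s j"
    using state_range_cover assms(2) .
  have "s < t" using assms(3) t s unfolding Y_pattern_def by blast
  have "c < Suc s * n_x S" "t * n_x S \<le> d"
    using block_range_bounds[of d "state_dim S" "num_subsys S" t i]
      block_range_bounds[of c "state_dim S" "num_subsys S" s j] t s
    by (simp_all add: n_x_def subsystems_def)
  moreover have "Suc s * n_x S \<le> t * n_x S" using \<open>s < t\<close> by (intro mult_right_mono) auto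
  ultimately show ?thesis by linarith
qed

lemma V_C_out_iff: "i \<in> V_C_out S j \<longleftrightarrow> j \<in> Cset S i"
  by (auto simp: V_C_out_def E_C_def Cset_def V_I_in_def)

lemma Q_pattern_absorbs_Y_pattern:
  assumes "d < N_x S" "Q_pattern S r d" "Y_pattern S d c"
  shows "Q_pattern S r c"
proof -
  obtain u k where u: "u \<le> horizon S" "k \<in> subsystems S" "d \<in> state_range S u k"
    using state_range_cover assms(1) .
  show ?thesis
    unfolding Q_pattern_def
  proof (intro allI ballI impI)
    fix t s i j
    assume *: "t < horizon S" "s \<le> horizon S" "i \<in> subsystems S" "j \<in> subsystems S"
      "r \<in> input_range S t i" "c \<in> state_range S s j"
    have "k \<in> Cset S i" "u \<le> t" using assms(2) u * unfolding Q_pattern_def by blast+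
    moreover have "V_C_out S k \<subseteq> V_C_out S j" "s < u"
      using assms(3) u * unfolding Y_pattern_def by blast+
    ultimately show "j \<in> Cset S i \<and> s \<le> t" by (auto simp flip: V_C_out_iff)
  qed
qed

section \<open>Invariance under the inverse\<close>

theorem lemma4:
  fixes S :: network and Y :: "real mat" and lam :: real
  assumes "wf_network S"
    and "Y \<in> Y_GC S"
    and "lam \<ge> 1"
  shows "invertible_mat (lam \<cdot>\<^sub>m 1\<^sub>m (N_x S) - Y) \<and>
    Q_C S = {Q\<xi> * the (mat_inverse (lam \<cdot>\<^sub>m 1\<^sub>m (N_x S) - Y)) | Q\<xi>. Q\<xi> \<in> Q_C S}"
proof
  let ?M = "lam \<cdot>\<^sub>m 1\<^sub>m (N_x S) - Y"
  let ?V = "the (mat_inverse ?M)"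
  have Y: "Y \<in> carrier_mat (N_x S) (N_x S)" using assms(2) by (simp add: Y_GC_def)
  note supp = Y_GC_supported[OF assms(2)]
  have lam: "lam \<noteq> 0" using assms(3) by simp
  have M: "?M \<in> carrier_mat (N_x S) (N_x S)" using Y by (rule minus_carrier_mat)
  have "det ?M \<noteq> 0"
    using det_shifted_strictly_lower[OF Y supp Y_pattern_strictly_lower, where a = lam] lam by simp
  note V = inverse_from_det[OF M this]
  show "invertible_mat ?M"
    unfolding invertible_mat_def inverts_mat_def using M V
    by (metis carrier_matD square_mat.simps)
  have mult_iff: "R * ?M \<in> Q_C S \<longleftrightarrow> R \<in> Q_C S" if R: "R \<in> carrier_mat (N_u S) (N_x S)" for R
  proof -
    have "supported (Q_pattern S) (R * ?M) \<longleftrightarrow> supported (Q_pattern S) R"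
      by (rule supported_mult_iff[OF R Y supp lam Y_pattern_strictly_lower
            Q_pattern_absorbs_Y_pattern])
    then show ?thesis using R mult_carrier_mat[OF R M] by (simp add: Q_C_iff_supported)
  qed
  have carrier: "R \<in> carrier_mat (N_u S) (N_x S)" if "R \<in> Q_C S" for R
    using that by (simp add: Q_C_iff_supported)
  show "Q_C S = {Q\<xi> * ?V | Q\<xi>. Q\<xi> \<in> Q_C S}"
  proof (intro equalityI subsetI)
    fix Q assume Q: "Q \<in> Q_C S"
    have "Q = Q * ?M * ?V"
      using assoc_mult_mat[OF carrier[OF Q] M V(1)] V(2) right_mult_one_mat[OF carrier[OF Q]]
      by simp
    then show "Q \<in> {Q\<xi> * ?V | Q\<xi>. Q\<xi> \<in> Q_C S}" using mult_iff[OF carrier[OF Q]] Q by blast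
  next
    fix Q assume "Q \<in> {Q\<xi> * ?V | Q\<xi>. Q\<xi> \<in> Q_C S}"
    then obtain R where R: "R \<in> Q_C S" and Q: "Q = R * ?V" by blast
    have "Q * ?M = R"
      using assoc_mult_mat[OF carrier[OF R] V(1) M] V(3) right_mult_one_mat[OF carrier[OF R]] Q
      by simp
    moreover have "Q \<in> carrier_mat (N_u S) (N_x S)"
      unfolding Q using carrier[OF R] V(1) by (rule mult_carrier_mat)
    ultimately show "Q \<in> Q_C S" using mult_iff R by metis
  qed
qed

end
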